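(* Consider the two-period setting described in the context. Assume: (Irreversible treatment) $D_{i,1}=1\implies D_{i,2}=1$ almost surely. (Exclusion) For each $z\in\{0,1\}$, $Y_{i,t}(0,z)=Y_{i,t}(0)$ and $Y_{i,t}(1,0,z)=Y_{i,t}(1,0)$ for $t\in\{1,2\}$, and $Y_{i,2}(1,1,z)=Y_{i,2}(1,1)$ (that is, potential outcomes do not depend on $z$). (Independence) $\big(Y_{i,1}(0),Y_{i,1}(1,0),Y_{i,2}(0),Y_{i,2}(1,0),Y_{i,2}(1,1),D_{i,1}(1),D_{i,1}(0),D_{i,2}(1),D_{i,2}(0)\big)$ is independent of $Z_i$. (Relevance at $t=1$) $FS_1\neq 0$. (Monotonicity at $t=1$) $\mathbb{P}(F_1)=0$. (Homogeneity) For any latent group $g\in\{(C_1,AT_2),(NT_1,C_2),(NT_1,F_2)\}$ such that $\mathbb{P}(g)>0$, $\Delta_1^0(C_1)=\Delta_2^0(g)$. Then $$\Delta_2^1(C_1)=\frac{RF_2}{FS_1}+\frac{(FS_1-FS_2)}{FS_1}\,\frac{RF_1}{FS_1}.$$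
   Context: Setting. Time is $t\in\{1,2\}$; $i$ denotes a generic observation. $Z_i\in\{0,1\}$ is a time-invariant binary instrument with $0<\mathbb{P}(Z_i=1)<1$. $D_{i,t}(z)\in\{0,1\}$ is the potential treatment status at $t$ under instrument value $z$, and the observed status is $D_{i,t}=D_{i,t}(Z_i)$. No unit is treated before period 1. $Y_{i,t}(0,z)$ is the potential outcome at $t$ if $i$ has not been treated up to $t$ and the instrument is $z$; $Y_{i,t}(1,\tau,z)$, $\tau\in\{0,\dots,t-1\}$, is the potential outcome at $t$ if $i$ is first treated at period $t-\tau$ and the instrument is $z$. The observed outcome $Y_{i,t}$ equals $Y_{i,t}(0,Z_i)$ if $i$ has not been treated up to $t$, and $Y_{i,t}(1,t-s,Z_i)$ if $i$ was first treated at $s\le t$. All expectations written are assumed to exist (one may take all potential outcomes to be integrable). Latent types at $t$ (events): $AT_t=\{D_{i,t}(1)=D_{i,t}(0)=1\}$, $C_t=\{D_{i,t}(1)>D_{i,t}(0)\}$, $F_t=\{D_{i,t}(1)<D_{i,t}(0)\}$, $NT_t=\{D_{i,t}(1)=D_{i,t}(0)=0\}$. A pair such as $(C_1,AT_2)$ denotes the intersection $C_1\cap AT_2$. Estimands: $RF_t=\mathbb{E}[Y_{i,t}\mid Z_i=1]-\mathbb{E}[Y_{i,t}\mid Z_i=0]$ and $FS_t=\mathbb{E}[D_{i,t}\mid Z_i=1]-\mathbb{E}[D_{i,t}\mid Z_i=0]$. Causal effects (under exclusion): for a latent group $g$, $\Delta_t^\tau(g)=\mathbb{E}[Y_{i,t}(1,\tau)-Y_{i,t}(0)\mid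 g]$. *)

theory Defs
  imports "HOL-Probability.Probability"
begin

text \<open>
  Periods are natural numbers, of which only 1 and 2 are used.  The instrument and the treatment
  status are Boolean (\<^term>\<open>True\<close> is 1).  \<open>D t z\<close> is the potential treatment
  at \<open>t\<close> under instrument value \<open>z\<close>; \<open>Y0 t z\<close> is the potential outcome
  \<open>Y\<^sub>t(0,z)\<close>; \<open>Y1 t \<tau> z\<close> is \<open>Y\<^sub>t(1,\<tau>,z)\<close>, where
  \<open>\<tau>\<close> is the number of periods since first treatment.
\<close>

definition cond_exp_event :: "'a measure \<Rightarrow> ('a \<Rightarrow> real) \<Rightarrow> 'a set \<Rightarrow> real" where
  "cond_exp_event M X A = (LINT \<omega>:A|M. X \<omega>) / measure M A"

text \<open>
  The library's \<^const>\<open>prob_space.indep_var\<close> forces both random variables to have the same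
  value type; this is the version for two different value types.
\<close>

definition indep_rvs ::
  "'a measure \<Rightarrow> 'b measure \<Rightarrow> ('a \<Rightarrow> 'b) \<Rightarrow> 'c measure \<Rightarrow> ('a \<Rightarrow> 'c) \<Rightarrow> bool" where
  "indep_rvs M S X T Y \<longleftrightarrow>
     X \<in> M \<rightarrow>\<^sub>M S \<and> Y \<in> M \<rightarrow>\<^sub>M T \<and>
     prob_space.indep_set M
       {X -` A \<inter> space M | A. A \<in> sets S}
       {Y -` B \<inter> space M | B. B \<in> sets T}"

definition obs_treatment ::
  "(nat \<Rightarrow> bool \<Rightarrow> 'a \<Rightarrow> bool) \<Rightarrow> ('a \<Rightarrow> bool) \<Rightarrow> nat \<Rightarrow> 'a \<Rightarrow> bool" where
  "obs_treatment D Z t \<omega> = D t (Z \<omega>) \<omega>"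

text \<open>
  Nobody is treated before period 1, so the period of first treatment is the least
  \<open>s \<ge> 1\<close> with observed treatment.
\<close>

definition obs_outcome ::
  "(nat \<Rightarrow> bool \<Rightarrow> 'a \<Rightarrow> bool) \<Rightarrow> (nat \<Rightarrow> bool \<Rightarrow> 'a \<Rightarrow> real) \<Rightarrow>
   (nat \<Rightarrow> nat \<Rightarrow> bool \<Rightarrow> 'a \<Rightarrow> real) \<Rightarrow> ('a \<Rightarrow> bool) \<Rightarrow> nat \<Rightarrow> 'a \<Rightarrow> real" where
  "obs_outcome D Y0 Y1 Z t \<omega> =
     (if \<exists>s\<in>{1..t}. obs_treatment D Z s \<omega>
      then Y1 t (t - (LEAST s. 1 \<le> s \<and> obs_treatment D Z s \<omega>)) (Z \<omega>) \<omega>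
      else Y0 t (Z \<omega>) \<omega>)"

definition always_takers ::
  "'a measure \<Rightarrow> (nat \<Rightarrow> bool \<Rightarrow> 'a \<Rightarrow> bool) \<Rightarrow> nat \<Rightarrow> 'a set" where
  "always_takers M D t = {\<omega> \<in> space M. D t True \<omega> \<and> D t False \<omega>}"

definition compliers ::
  "'a measure \<Rightarrow> (nat \<Rightarrow> bool \<Rightarrow> 'a \<Rightarrow> bool) \<Rightarrow> nat \<Rightarrow> 'a set" where
  "compliers M D t = {\<omega> \<in> space M. D t True \<omega> \<and> \<not> D t False \<omega>}"

definition defiers ::
  "'a measure \<Rightarrow> (nat \<Rightarrow> bool \<Rightarrow> 'a \<Rightarrow> bool) \<Rightarrow> nat \<Rightarrow> 'a set" where
  "defiers M D t = {\<omega> \<in> space M. \<not> D t True \<omega> \<and> D t False \<omega>}"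

definition never_takers ::
  "'a measure \<Rightarrow> (nat \<Rightarrow> bool \<Rightarrow> 'a \<Rightarrow> bool) \<Rightarrow> nat \<Rightarrow> 'a set" where
  "never_takers M D t = {\<omega> \<in> space M. \<not> D t True \<omega> \<and> \<not> D t False \<omega>}"

definition instrument_contrast :: "'a measure \<Rightarrow> ('a \<Rightarrow> bool) \<Rightarrow> ('a \<Rightarrow> real) \<Rightarrow> real" where
  "instrument_contrast M Z X =
     cond_exp_event M X {\<omega> \<in> space M. Z \<omega>} - cond_exp_event M X {\<omega> \<in> space M. \<not> Z \<omega>}"

definition reduced_form ::
  "'a measure \<Rightarrow> (nat \<Rightarrow> bool \<Rightarrow> 'a \<Rightarrow> bool) \<Rightarrow> (nat \<Rightarrow> bool \<Rightarrow> 'a \<Rightarrow> real) \<Rightarrow>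
   (nat \<Rightarrow> nat \<Rightarrow> bool \<Rightarrow> 'a \<Rightarrow> real) \<Rightarrow> ('a \<Rightarrow> bool) \<Rightarrow> nat \<Rightarrow> real" where
  "reduced_form M D Y0 Y1 Z t = instrument_contrast M Z (obs_outcome D Y0 Y1 Z t)"

definition first_stage ::
  "'a measure \<Rightarrow> (nat \<Rightarrow> bool \<Rightarrow> 'a \<Rightarrow> bool) \<Rightarrow> ('a \<Rightarrow> bool) \<Rightarrow> nat \<Rightarrow> real" where
  "first_stage M D Z t = instrument_contrast M Z (\<lambda>\<omega>. of_bool (obs_treatment D Z t \<omega>))"

text \<open>
  \<open>causal_effect M Y0 Y1 \<tau> t g\<close> is \<open>\<Delta>\<^sub>t\<^sup>\<tau>(g)\<close>; here
  \<open>Y0\<close> and \<open>Y1\<close> are the potential outcomes without the instrument argument.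
\<close>

definition causal_effect ::
  "'a measure \<Rightarrow> (nat \<Rightarrow> 'a \<Rightarrow> real) \<Rightarrow> (nat \<Rightarrow> nat \<Rightarrow> 'a \<Rightarrow> real) \<Rightarrow>
   nat \<Rightarrow> nat \<Rightarrow> 'a set \<Rightarrow> real" where
  "causal_effect M Y0 Y1 \<tau> t g = cond_exp_event M (\<lambda>\<omega>. Y1 t \<tau> \<omega> - Y0 t \<omega>) g"

end

theory Submission
  imports Defs
begin

text \<open>
  By independence, the contrast of an outcome between the two instrument arms is the unconditional
  mean difference of the outcomes that the two arms select.  Irreversibility holds given each
  instrument value, hence by independence for the potential treatments: almost surely
  \<open>D 1 z \<omega>\<close> implies \<open>D 2 z \<omega>\<close>.  Crossing the types of both periods then gives
  \<open>RF\<^sub>2\<close> as the total two-period effect on \<open>C\<^sub>1\<close> plus one-period effects on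
  \<open>(C\<^sub>1, AT\<^sub>2)\<close>, \<open>(NT\<^sub>1, C\<^sub>2)\<close> and \<open>(NT\<^sub>1, F\<^sub>2)\<close> with signs
  \<open>-, +, -\<close>.  By homogeneity the latter add up to
  \<open>\<delta> (FS\<^sub>2 - FS\<^sub>1)\<close> with \<open>\<delta> = \<Delta>\<^sub>1\<^sup>0(C\<^sub>1) = RF\<^sub>1 / FS\<^sub>1\<close>,
  and \<open>FS\<^sub>1 = P(C\<^sub>1)\<close>.  Both first stages and \<open>RF\<^sub>1\<close> come out of the same
  decomposition by replacing the period-2 outcomes with constants or with period-1 outcomes.
\<close>

section \<open>Independence and conditional means given the instrument\<close>

text \<open>Every preimage under a composition is already a preimage under the inner variable, and
  independence passes to smaller families of events. Mapping both variables into one value type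
  opens the way to the product rule for expectations.\<close>

lemma (in prob_space) indep_rvs_imp_indep_var_compose:
  assumes indep: "indep_rvs M S V T Z"
    and f: "f \<in> S \<rightarrow>\<^sub>M N" and g: "g \<in> T \<rightarrow>\<^sub>M K"
  shows "indep_var N (\<lambda>\<omega>. f (V \<omega>)) K (\<lambda>\<omega>. g (Z \<omega>))"
proof -
  have V: "V \<in> M \<rightarrow>\<^sub>M S" and Z: "Z \<in> M \<rightarrow>\<^sub>M T"
    and ind: "indep_set {V -` A \<inter> space M | A. A \<in> sets S} {Z -` B \<inter> space M | B. B \<in> sets T}"
    using indep unfolding indep_rvs_def by auto
  have pull: "{(\<lambda>\<omega>. h (X \<omega>)) -` A \<inter> space M | A. A \<in> sets L'} \<subseteq> {X -` A \<inter> space M | A. A \<in> sets L}"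
    if X: "X \<in> M \<rightarrow>\<^sub>M L" and h: "h \<in> L \<rightarrow>\<^sub>M L'" for X :: "'a \<Rightarrow> 'x" and h :: "'x \<Rightarrow> 'y" and L L'
  proof safe
    fix A assume "A \<in> sets L'"
    then have "h -` A \<inter> space L \<in> sets L"
      using h by simp
    moreover have "(\<lambda>\<omega>. h (X \<omega>)) -` A \<inter> space M = X -` (h -` A \<inter> space L) \<inter> space M"
      using measurable_space[OF X] by auto
    ultimately show "\<exists>B. (\<lambda>\<omega>. h (X \<omega>)) -` A \<inter> space M = X -` B \<inter> space M \<and> B \<in> sets L"
      by blast
  qed
  show ?thesis
    unfolding indep_var_def indep_vars_def2
  proof (intro conjI ballI)
    show "random_variable (case_bool N K i) (case_bool (\<lambda>\<omega>. f (V \<omega>)) (\<lambda>\<omega>. g (Z \<omega>)) i)" for i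
      using V Z f g by (cases i) auto
    show "indep_sets (\<lambda>i. {case_bool (\<lambda>\<omega>. f (V \<omega>)) (\<lambda>\<omega>. g (Z \<omega>)) i -` A \<inter> space M | A.
        A \<in> sets (case_bool N K i)}) UNIV"
      using ind unfolding indep_set_def
    proof (rule indep_sets_mono_sets)
      fix i
      show "{case_bool (\<lambda>\<omega>. f (V \<omega>)) (\<lambda>\<omega>. g (Z \<omega>)) i -` A \<inter> space M | A. A \<in> sets (case_bool N K i)}
        \<subseteq> (case i of True \<Rightarrow> {V -` A \<inter> space M | A. A \<in> sets S}
                | False \<Rightarrow> {Z -` B \<inter> space M | B. B \<in> sets T})"
        using pull[OF V f] pull[OF Z g] by (cases i) simp_all
    qed
  qed
qed

text \<open>On the event, \<open>X\<close> may be replaced by \<open>f\<close> of \<open>V\<close>;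
  by independence the integral factors into the unconditional mean and the probability of the event,
  which cancels. Agreement is only asked for almost surely, as exclusion and irreversibility provide
  no more.\<close>

lemma (in prob_space) cond_exp_event_indep_rvs:
  fixes f :: "'b \<Rightarrow> real" and Z :: "'a \<Rightarrow> 'c"
  assumes indep: "indep_rvs M S V (count_space UNIV) Z"
    and f: "f \<in> borel_measurable S" "integrable M (\<lambda>\<omega>. f (V \<omega>))"
    and X: "X \<in> borel_measurable M" "AE \<omega> in M. Z \<omega> = z \<longrightarrow> X \<omega> = f (V \<omega>)"
    and pos: "prob {\<omega> \<in> space M. Z \<omega> = z} \<noteq> 0"
  shows "cond_exp_event M X {\<omega> \<in> space M. Z \<omega> = z} = expectation (\<lambda>\<omega>. f (V \<omega>))"
proof -
  let ?A = "{\<omega> \<in> space M. Z \<omega> = z}"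
  have [measurable]: "Z \<in> M \<rightarrow>\<^sub>M count_space UNIV"
    using indep unfolding indep_rvs_def by auto
  have A[measurable]: "?A \<in> sets M" by measurable
  have [measurable]: "(\<lambda>\<omega>. f (V \<omega>)) \<in> borel_measurable M"
    using f(2) by auto
  have eq: "indicator {z} (Z \<omega>) = (indicator ?A \<omega> :: real)" if "\<omega> \<in> space M" for \<omega>
    using that by (auto simp: indicator_def)
  have int_ind: "integrable M (\<lambda>\<omega>. indicator {z} (Z \<omega>) :: real)"
    by (intro integrable_const_bound[of _ 1]) (auto simp: indicator_def)
  have "(LINT \<omega>:?A|M. X \<omega>) = expectation (\<lambda>\<omega>. f (V \<omega>) * indicator {z} (Z \<omega>))"
    unfolding set_lebesgue_integral_def using X
    by (intro integral_cong_AE) (auto simp: indicator_def)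
  also have "\<dots> = expectation (\<lambda>\<omega>. f (V \<omega>)) * expectation (\<lambda>\<omega>. indicator {z} (Z \<omega>))"
    by (intro indep_var_lebesgue_integral f(2) int_ind
        indep_rvs_imp_indep_var_compose[OF indep f(1)]) simp
  also have "expectation (\<lambda>\<omega>. indicator {z} (Z \<omega>) :: real) = prob ?A"
    using Bochner_Integration.integral_cong[OF refl eq, of M] by simp
  finally show ?thesis
    using pos unfolding cond_exp_event_def by simp
qed

section \<open>Outcomes selected by an instrument arm, and their contrast by latent group\<close>

text \<open>
  \<open>xk\<close> is the outcome after \<open>k\<close> periods of treatment, as seen from period 2.
\<close>

definition selected_outcome ::
  "(nat \<Rightarrow> bool \<Rightarrow> 'a \<Rightarrow> bool) \<Rightarrow> ('a \<Rightarrow> real) \<Rightarrow> ('a \<Rightarrow> real) \<Rightarrow> ('a \<Rightarrow> real) \<Rightarrow> bool \<Rightarrow> 'a \<Rightarrow> real" where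
  "selected_outcome D x0 x1 x2 z \<omega> = (if D 1 z \<omega> then x2 \<omega> else if D 2 z \<omega> then x1 \<omega> else x0 \<omega>)"

lemma borel_measurable_selected_outcome [measurable]:
  assumes [measurable]: "D 1 z \<in> M \<rightarrow>\<^sub>M count_space UNIV" "D 2 z \<in> M \<rightarrow>\<^sub>M count_space UNIV"
    "x0 \<in> borel_measurable M" "x1 \<in> borel_measurable M" "x2 \<in> borel_measurable M"
  shows "selected_outcome D x0 x1 x2 z \<in> borel_measurable M"
  unfolding selected_outcome_def[abs_def] by measurable

lemma integrable_selected_outcome:
  assumes [measurable]: "D 1 z \<in> M \<rightarrow>\<^sub>M count_space UNIV" "D 2 z \<in> M \<rightarrow>\<^sub>M count_space UNIV"
    and int: "integrable M x0" "integrable M x1" "integrable M x2"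
  shows "integrable M (selected_outcome D x0 x1 x2 z)"
proof (rule Bochner_Integration.integrable_bound)
  show "integrable M (\<lambda>\<omega>. \<bar>x0 \<omega>\<bar> + \<bar>x1 \<omega>\<bar> + \<bar>x2 \<omega>\<bar>)"
    using int by simp
  show "selected_outcome D x0 x1 x2 z \<in> borel_measurable M"
    using int by measurable
qed (auto simp: selected_outcome_def)

text \<open>
  Always-takers of period 1 contribute nothing.  The minus sign on the second group arises because
  starting early costs these units the one-period treatment they would otherwise get in period 2.
\<close>

lemma selected_outcome_contrast:
  assumes D[measurable]: "\<And>z. D 1 z \<in> M \<rightarrow>\<^sub>M count_space UNIV" "\<And>z. D 2 z \<in> M \<rightarrow>\<^sub>M count_space UNIV"
    and irreversible: "\<And>z. AE \<omega> in M. D 1 z \<omega> \<longrightarrow> D 2 z \<omega>"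
    and monotone: "AE \<omega> in M. D 1 False \<omega> \<longrightarrow> D 1 True \<omega>"
    and int: "integrable M x0" "integrable M x1" "integrable M x2"
  shows "integral\<^sup>L M (selected_outcome D x0 x1 x2 True) - integral\<^sup>L M (selected_outcome D x0 x1 x2 False) =
    (LINT \<omega>:compliers M D 1|M. x2 \<omega> - x0 \<omega>)
    - (LINT \<omega>:compliers M D 1 \<inter> always_takers M D 2|M. x1 \<omega> - x0 \<omega>)
    + (LINT \<omega>:never_takers M D 1 \<inter> compliers M D 2|M. x1 \<omega> - x0 \<omega>)
    - (LINT \<omega>:never_takers M D 1 \<inter> defiers M D 2|M. x1 \<omega> - x0 \<omega>)"
proof -
  let ?S = "selected_outcome D x0 x1 x2"
  let ?C = "compliers M D 1"
  let ?CA = "compliers M D 1 \<inter> always_takers M D 2"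
  let ?NC = "never_takers M D 1 \<inter> compliers M D 2"
  let ?NF = "never_takers M D 1 \<inter> defiers M D 2"
  \<comment> \<open>Period \<open>1\<close> must not be rewritten to \<open>Suc 0\<close>, so that
    facts about \<open>D 1\<close> keep matching.\<close>
  note One_nat_def [simp del]
  have [measurable]: "x0 \<in> borel_measurable M" "x1 \<in> borel_measurable M" "x2 \<in> borel_measurable M"
    using int by auto
  have sets[measurable]: "?C \<in> sets M" "?CA \<in> sets M" "?NC \<in> sets M" "?NF \<in> sets M"
    unfolding compliers_def always_takers_def never_takers_def defiers_def by measurable
  have intS: "integrable M (?S z)" for z
    by (intro integrable_selected_outcome int) measurable
  have set_int: "integrable M (\<lambda>\<omega>. indicator A \<omega> *\<^sub>R (x \<omega> - x0 \<omega>))"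
    if "A \<in> sets M" "integrable M x" for A and x :: "'a \<Rightarrow> real"
    using that int by (intro integrable_mult_indicator) auto
  have "integral\<^sup>L M (?S True) - integral\<^sup>L M (?S False) = (LINT \<omega>|M. ?S True \<omega> - ?S False \<omega>)"
    using intS by simp
  also have "\<dots> = (LINT \<omega>|M. indicator ?C \<omega> *\<^sub>R (x2 \<omega> - x0 \<omega>)
      - indicator ?CA \<omega> *\<^sub>R (x1 \<omega> - x0 \<omega>)
      + indicator ?NC \<omega> *\<^sub>R (x1 \<omega> - x0 \<omega>)
      - indicator ?NF \<omega> *\<^sub>R (x1 \<omega> - x0 \<omega>))"
  proof (rule integral_cong_AE)
    show "AE \<omega> in M. ?S True \<omega> - ?S False \<omega> = indicator ?C \<omega> *\<^sub>R (x2 \<omega> - x0 \<omega>)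
        - indicator ?CA \<omega> *\<^sub>R (x1 \<omega> - x0 \<omega>)
        + indicator ?NC \<omega> *\<^sub>R (x1 \<omega> - x0 \<omega>)
        - indicator ?NF \<omega> *\<^sub>R (x1 \<omega> - x0 \<omega>)"
      using irreversible[of True] irreversible[of False] monotone AE_space
    proof eventually_elim
      case (elim \<omega>)
      \<comment> \<open>Seven treatment patterns survive the constraints. For \<open>?C\<close>,
        \<open>D 2 False\<close> decides between \<open>x2 - x0\<close> and \<open>x2 - x1\<close>,
        the latter being \<open>(x2 - x0) - (x1 - x0)\<close>. Never-takers of period 1 give
        \<open>x1 - x0\<close>, \<open>x0 - x1\<close> or 0.\<close>
      then show ?case
        by (cases "D 1 True \<omega>"; cases "D 1 False \<omega>"; cases "D 2 True \<omega>"; cases "D 2 False \<omega>")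
          (simp_all add: selected_outcome_def indicator_def compliers_def always_takers_def
            never_takers_def defiers_def)
    qed
  qed measurable
  also have "\<dots> = (LINT \<omega>:?C|M. x2 \<omega> - x0 \<omega>) - (LINT \<omega>:?CA|M. x1 \<omega> - x0 \<omega>)
      + (LINT \<omega>:?NC|M. x1 \<omega> - x0 \<omega>) - (LINT \<omega>:?NF|M. x1 \<omega> - x0 \<omega>)"
    unfolding set_lebesgue_integral_def
    by (simp only: Bochner_Integration.integral_diff Bochner_Integration.integral_add
        Bochner_Integration.integrable_diff Bochner_Integration.integrable_add
        set_int[OF sets(1) int(3)] set_int[OF sets(2) int(2)]
        set_int[OF sets(3) int(2)] set_int[OF sets(4) int(2)])
  finally show ?thesis .
qed

section \<open>Group means on null sets, and observed outcomes made explicit\<close>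

text \<open>On a null set the quotient is 0 by the convention for division by zero, and the integral
  vanishes too. Latent groups of probability zero can therefore stay in the decomposition.\<close>

lemma set_integral_eq_cond_exp_event:
  assumes "finite_measure M" "A \<in> sets M"
  shows "(LINT \<omega>:A|M. X \<omega>) = cond_exp_event M X A * measure M A"
proof (cases "measure M A = 0")
  case True
  then have "A \<in> null_sets M"
    using assms by (auto simp: finite_measure.emeasure_eq_measure)
  then have "AE \<omega> in M. indicator A \<omega> *\<^sub>R X \<omega> = 0"
    by (auto dest!: AE_not_in elim!: eventually_mono)
  then have "(LINT \<omega>:A|M. X \<omega>) = 0"
    unfolding set_lebesgue_integral_def by (rule integral_eq_zero_AE)
  with True show ?thesis by simp
qed (simp add: cond_exp_event_def)

lemma obs_outcome_1:
  "obs_outcome D Y0 Y1 Z 1 \<omega> = (if D 1 (Z \<omega>) \<omega> then Y1 1 0 (Z \<omega>) \<omega> else Y0 1 (Z \<omega>) \<omega>)"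
proof -
  have "(LEAST s. 1 \<le> s \<and> D s (Z \<omega>) \<omega>) = 1" if "D 1 (Z \<omega>) \<omega>"
    using that by (intro Least_equality) auto
  then show ?thesis
    unfolding obs_outcome_def obs_treatment_def by simp
qed

text \<open>The date of first treatment fixes the time elapsed at period 2: date 1 gives 1, date 2
  gives 0. This is why \<open>D 1\<close> is tested before \<open>D 2\<close>.\<close>

lemma obs_outcome_2:
  "obs_outcome D Y0 Y1 Z 2 \<omega> =
    selected_outcome D (Y0 2 (Z \<omega>)) (Y1 2 0 (Z \<omega>)) (Y1 2 1 (Z \<omega>)) (Z \<omega>) \<omega>"
proof -
  have "{1..2} = {1, 2::nat}" by auto
  moreover have "(LEAST s. 1 \<le> s \<and> D s (Z \<omega>) \<omega>) = 1" if "D 1 (Z \<omega>) \<omega>"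
    using that by (intro Least_equality) auto
  moreover have "(LEAST s. 1 \<le> s \<and> D s (Z \<omega>) \<omega>) = 2" if "\<not> D 1 (Z \<omega>) \<omega>" "D 2 (Z \<omega>) \<omega>"
  proof (intro Least_equality)
    fix s assume s: "1 \<le> s \<and> D s (Z \<omega>) \<omega>"
    then have "s \<noteq> 1" using that by metis
    with s show "2 \<le> s" by linarith
  qed (use that in auto)
  ultimately show ?thesis
    unfolding obs_outcome_def obs_treatment_def selected_outcome_def
    by simp
qed

theorem proposition2p2:
  fixes M :: "'a measure"
    and Z :: "'a \<Rightarrow> bool"
    and D :: "nat \<Rightarrow> bool \<Rightarrow> 'a \<Rightarrow> bool"
    and Y0z :: "nat \<Rightarrow> bool \<Rightarrow> 'a \<Rightarrow> real"
    and Y1z :: "nat \<Rightarrow> nat \<Rightarrow> bool \<Rightarrow> 'a \<Rightarrow> real"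
    and Y0 :: "nat \<Rightarrow> 'a \<Rightarrow> real"
    and Y1 :: "nat \<Rightarrow> nat \<Rightarrow> 'a \<Rightarrow> real"
  assumes prob: "prob_space M"
    and instrument: "0 < \<P>(\<omega> in M. Z \<omega>)" "\<P>(\<omega> in M. Z \<omega>) < 1"
    and integrable_untreated: "\<forall>t\<in>{1, 2}. \<forall>z. integrable M (Y0z t z)"
    and integrable_treated: "\<forall>t\<in>{1, 2}. \<forall>\<tau><t. \<forall>z. integrable M (Y1z t \<tau> z)"
    and irreversible:
      "AE \<omega> in M. obs_treatment D Z 1 \<omega> \<longrightarrow> obs_treatment D Z 2 \<omega>"
    and exclusion_untreated: "\<forall>t\<in>{1, 2}. \<forall>z. AE \<omega> in M. Y0z t z \<omega> = Y0 t \<omega>"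
    and exclusion_treated:
      "\<forall>t\<in>{1, 2}. \<forall>\<tau><t. \<forall>z. AE \<omega> in M. Y1z t \<tau> z \<omega> = Y1 t \<tau> \<omega>"
    and independence:
      "indep_rvs M
         (borel \<Otimes>\<^sub>M borel \<Otimes>\<^sub>M borel \<Otimes>\<^sub>M borel \<Otimes>\<^sub>M borel \<Otimes>\<^sub>M
          count_space UNIV \<Otimes>\<^sub>M count_space UNIV \<Otimes>\<^sub>M count_space UNIV \<Otimes>\<^sub>M count_space UNIV)
         (\<lambda>\<omega>. (Y0 1 \<omega>, Y1 1 0 \<omega>, Y0 2 \<omega>, Y1 2 0 \<omega>, Y1 2 1 \<omega>,
                D 1 True \<omega>, D 1 False \<omega>, D 2 True \<omega>, D 2 False \<omega>))
         (count_space UNIV) Z"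
    and relevance: "first_stage M D Z 1 \<noteq> 0"
    and monotonicity: "measure M (defiers M D 1) = 0"
    and homogeneity:
      "\<forall>g\<in>{compliers M D 1 \<inter> always_takers M D 2,
             never_takers M D 1 \<inter> compliers M D 2,
             never_takers M D 1 \<inter> defiers M D 2}.
         measure M g > 0 \<longrightarrow>
         causal_effect M Y0 Y1 0 1 (compliers M D 1) = causal_effect M Y0 Y1 0 2 g"
  shows "causal_effect M Y0 Y1 1 2 (compliers M D 1) =
    reduced_form M D Y0z Y1z Z 2 / first_stage M D Z 1 +
    (first_stage M D Z 1 - first_stage M D Z 2) / first_stage M D Z 1 *
      (reduced_form M D Y0z Y1z Z 1 / first_stage M D Z 1)"
proof -
  interpret prob_space M by (rule prob)
  note One_nat_def [simp del]

  \<comment> \<open>The independent vector, its coordinates, and integrability\<close>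
  let ?S = "borel \<Otimes>\<^sub>M borel \<Otimes>\<^sub>M borel \<Otimes>\<^sub>M borel \<Otimes>\<^sub>M borel \<Otimes>\<^sub>M
    count_space UNIV \<Otimes>\<^sub>M count_space UNIV \<Otimes>\<^sub>M count_space UNIV \<Otimes>\<^sub>M count_space UNIV
    :: (real \<times> real \<times> real \<times> real \<times> real \<times> bool \<times> bool \<times> bool \<times> bool) measure"
  define V where "V \<omega> = (Y0 1 \<omega>, Y1 1 0 \<omega>, Y0 2 \<omega>, Y1 2 0 \<omega>, Y1 2 1 \<omega>,
    D 1 True \<omega>, D 1 False \<omega>, D 2 True \<omega>, D 2 False \<omega>)" for \<omega>
  have indep: "indep_rvs M ?S V (count_space UNIV) Z"
    using independence unfolding V_def[abs_def] .
  then have V[measurable]: "V \<in> M \<rightarrow>\<^sub>M ?S" and Z[measurable]: "Z \<in> M \<rightarrow>\<^sub>M count_space UNIV"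
    unfolding indep_rvs_def by auto

  define y01 y10 y02 y20 y21 :: "real \<times> real \<times> real \<times> real \<times> real \<times> bool \<times> bool \<times> bool \<times> bool \<Rightarrow> real"
    where "y01 = fst"
      and "y10 = fst \<circ> snd"
      and "y02 = fst \<circ> snd \<circ> snd"
      and "y20 = fst \<circ> snd \<circ> snd \<circ> snd"
      and "y21 = fst \<circ> snd \<circ> snd \<circ> snd \<circ> snd"
  \<comment> \<open>Any \<open>t\<close> other than 1 stands for period 2. With the same argument
    order as \<open>D\<close>, \<open>d\<close> lets \<open>selected_outcome\<close> be formed on
    the value space of \<open>V\<close>.\<close>
  define d :: "nat \<Rightarrow> bool \<Rightarrow> real \<times> real \<times> real \<times> real \<times> real \<times> bool \<times> bool \<times> bool \<times> bool \<Rightarrow> bool"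
    where "d = (\<lambda>t z (_, _, _, _, _, d1t, d1f, d2t, d2f).
      if t = 1 then (if z then d1t else d1f) else (if z then d2t else d2f))"
  note proj_defs = y01_def y10_def y02_def y20_def y21_def d_def
  have [measurable]: "y01 \<in> borel_measurable ?S" "y10 \<in> borel_measurable ?S"
    "y02 \<in> borel_measurable ?S" "y20 \<in> borel_measurable ?S" "y21 \<in> borel_measurable ?S"
    unfolding proj_defs split_beta' comp_def by measurable
  have d[measurable]: "d t z \<in> ?S \<rightarrow>\<^sub>M count_space UNIV" for t z
    unfolding proj_defs split_beta' comp_def by (cases z; cases "t = 1"; simp)
  have proj: "y01 (V \<omega>) = Y0 1 \<omega>" "y10 (V \<omega>) = Y1 1 0 \<omega>" "y02 (V \<omega>) = Y0 2 \<omega>"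
    "y20 (V \<omega>) = Y1 2 0 \<omega>" "y21 (V \<omega>) = Y1 2 1 \<omega>"
    "d 1 z (V \<omega>) = D 1 z \<omega>" "d 2 z (V \<omega>) = D 2 z \<omega>" for z \<omega>
    by (auto simp: V_def proj_defs)

  have D[measurable]: "D 1 z \<in> M \<rightarrow>\<^sub>M count_space UNIV" "D 2 z \<in> M \<rightarrow>\<^sub>M count_space UNIV" for z
    using measurable_compose[OF V d[of 1 z], unfolded proj]
      measurable_compose[OF V d[of 2 z], unfolded proj] by blast+
  \<comment> \<open>The instrument takes countably many values, so measurability can be checked with
    its value fixed.\<close>
  have [measurable]: "(\<lambda>\<omega>. D 1 (Z \<omega>) \<omega>) \<in> M \<rightarrow>\<^sub>M count_space UNIV"
    "(\<lambda>\<omega>. D 2 (Z \<omega>) \<omega>) \<in> M \<rightarrow>\<^sub>M count_space UNIV"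
    by (rule measurable_compose_countable'[where I = UNIV]; auto)+
  have V_comps: "(\<lambda>\<omega>. y01 (V \<omega>)) = Y0 1" "(\<lambda>\<omega>. y10 (V \<omega>)) = Y1 1 0" "(\<lambda>\<omega>. y02 (V \<omega>)) = Y0 2"
    "(\<lambda>\<omega>. y20 (V \<omega>)) = Y1 2 0" "(\<lambda>\<omega>. y21 (V \<omega>)) = Y1 2 1"
    by (auto simp: proj)
  have Ymeas[measurable]: "Y0 1 \<in> borel_measurable M" "Y1 1 0 \<in> borel_measurable M"
    "Y0 2 \<in> borel_measurable M" "Y1 2 0 \<in> borel_measurable M" "Y1 2 1 \<in> borel_measurable M"
    unfolding V_comps[symmetric] by measurable
  have Y0z_int: "integrable M (Y0z t z)" if "t \<in> {1, 2}" for t z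
    using integrable_untreated that by auto
  have Y1z_int: "integrable M (Y1z t \<tau> z)" if "t \<in> {1, 2}" "\<tau> < t" for t \<tau> z
    using integrable_treated that by auto
  have Y0_eq: "AE \<omega> in M. Y0z t z \<omega> = Y0 t \<omega>" if "t \<in> {1, 2}" for t z
    using exclusion_untreated that by auto
  have Y1_eq: "AE \<omega> in M. Y1z t \<tau> z \<omega> = Y1 t \<tau> \<omega>" if "t \<in> {1, 2}" "\<tau> < t" for t \<tau> z
    using exclusion_treated that by auto
  \<comment> \<open>Integrability is assumed for the outcomes indexed by \<open>z\<close>. It
    transfers along almost sure equality because the limits of exclusion are coordinates of
    \<open>V\<close>, hence measurable.\<close>
  have Yint: "integrable M (Y0 1)" "integrable M (Y1 1 0)" "integrable M (Y0 2)"
    "integrable M (Y1 2 0)" "integrable M (Y1 2 1)"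
    using integrable_cong_AE_imp[OF Y0z_int Ymeas(1) Y0_eq]
      integrable_cong_AE_imp[OF Y1z_int Ymeas(2) Y1_eq]
      integrable_cong_AE_imp[OF Y0z_int Ymeas(3) Y0_eq]
      integrable_cong_AE_imp[OF Y1z_int Ymeas(4) Y1_eq]
      integrable_cong_AE_imp[OF Y1z_int Ymeas(5) Y1_eq]
    by auto

  \<comment> \<open>Contrasts between the instrument arms\<close>
  have Z_pos: "prob {\<omega> \<in> space M. Z \<omega> = z} \<noteq> 0" for z
  proof (cases z)
    case True
    then show ?thesis using instrument by simp
  next
    case False
    have "prob {\<omega> \<in> space M. \<not> Z \<omega>} = 1 - prob {\<omega> \<in> space M. Z \<omega>}"
      by (rule prob_neg) measurable
    then show ?thesis using False instrument by simp
  qed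
  note cond_V = cond_exp_event_indep_rvs[OF indep _ _ _ _ Z_pos]
  have contrast_V: "instrument_contrast M Z X =
      expectation (\<lambda>\<omega>. f True (V \<omega>)) - expectation (\<lambda>\<omega>. f False (V \<omega>))"
    if "\<And>z. f z \<in> borel_measurable ?S" "\<And>z. integrable M (\<lambda>\<omega>. f z (V \<omega>))"
      "X \<in> borel_measurable M" "\<And>z. AE \<omega> in M. Z \<omega> = z \<longrightarrow> X \<omega> = f z (V \<omega>)" for X f
    unfolding instrument_contrast_def
    using cond_V[OF that(1,2,3,4), of True] cond_V[OF that(1,2,3,4), of False] by simp

  \<comment> \<open>Irreversibility and monotonicity of the potential treatments\<close>
  have irreversible': "AE \<omega> in M. D 1 z \<omega> \<longrightarrow> D 2 z \<omega>" for z
  proof -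
    \<comment> \<open>\<open>f\<close> flags a violation at the fixed \<open>z\<close>. In the arm
      \<open>Z = z\<close> it is almost surely 0, so by independence its unconditional mean is 0;
      being nonnegative, it vanishes almost surely.\<close>
    define f where "f v = (of_bool (d 1 z v \<and> \<not> d 2 z v) :: real)" for v
    have [measurable]: "f \<in> borel_measurable ?S"
      unfolding f_def[abs_def] by measurable
    have f_int: "integrable M (\<lambda>\<omega>. f (V \<omega>))"
      by (intro integrable_const_bound[of _ 1]) (auto simp: f_def)
    have "cond_exp_event M (\<lambda>_. 0) {\<omega> \<in> space M. Z \<omega> = z} = expectation (\<lambda>\<omega>. f (V \<omega>))"
    proof (rule cond_V)
      show "AE \<omega> in M. Z \<omega> = z \<longrightarrow> 0 = f (V \<omega>)"
        using irreversible
        by eventually_elim (auto simp: f_def proj obs_treatment_def)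
    qed (use f_int in auto)
    then have "expectation (\<lambda>\<omega>. f (V \<omega>)) = 0"
      by (simp add: cond_exp_event_def set_lebesgue_integral_def)
    then have "AE \<omega> in M. f (V \<omega>) = 0"
      using f_int by (subst (asm) integral_nonneg_eq_0_iff_AE) (auto simp: f_def)
    then show ?thesis
      by eventually_elim (auto simp: f_def proj)
  qed
  have monotone: "AE \<omega> in M. D 1 False \<omega> \<longrightarrow> D 1 True \<omega>"
  proof -
    have "defiers M D 1 \<in> null_sets M"
      using monotonicity by (auto simp: emeasure_eq_measure defiers_def)
    then have "AE \<omega> in M. \<omega> \<notin> defiers M D 1"
      by (rule AE_not_in)
    then show ?thesis
      using AE_space by eventually_elim (auto simp: defiers_def)
  qed
  note contrast = selected_outcome_contrast[of D, OF D irreversible' monotone]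

  \<comment> \<open>Instrument contrasts by latent group\<close>
  let ?C = "compliers M D 1"
  let ?CA = "compliers M D 1 \<inter> always_takers M D 2"
  let ?NC = "never_takers M D 1 \<inter> compliers M D 2"
  let ?NF = "never_takers M D 1 \<inter> defiers M D 2"
  have sets: "?C \<in> sets M" "?CA \<in> sets M" "?NC \<in> sets M" "?NF \<in> sets M"
    unfolding compliers_def always_takers_def never_takers_def defiers_def by measurable
  let ?\<delta> = "causal_effect M Y0 Y1 0 1 ?C"

  \<comment> \<open>Outcomes are functions of \<open>V\<close> so that independence applies; the
    almost sure agreement in each arm absorbs exclusion and irreversibility.\<close>
  have sel_V: "instrument_contrast M Z X =
      (LINT \<omega>:?C|M. x2 (V \<omega>) - x0 (V \<omega>)) - (LINT \<omega>:?CA|M. x1 (V \<omega>) - x0 (V \<omega>))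
      + (LINT \<omega>:?NC|M. x1 (V \<omega>) - x0 (V \<omega>)) - (LINT \<omega>:?NF|M. x1 (V \<omega>) - x0 (V \<omega>))"
    if x[measurable]: "x0 \<in> borel_measurable ?S" "x1 \<in> borel_measurable ?S" "x2 \<in> borel_measurable ?S"
      and int: "integrable M (\<lambda>\<omega>. x0 (V \<omega>))" "integrable M (\<lambda>\<omega>. x1 (V \<omega>))" "integrable M (\<lambda>\<omega>. x2 (V \<omega>))"
      and X: "X \<in> borel_measurable M"
        "\<And>z. AE \<omega> in M. Z \<omega> = z \<longrightarrow>
          X \<omega> = selected_outcome D (\<lambda>\<omega>. x0 (V \<omega>)) (\<lambda>\<omega>. x1 (V \<omega>)) (\<lambda>\<omega>. x2 (V \<omega>)) z \<omega>"
    for X x0 x1 x2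
  proof -
    have eq: "selected_outcome d x0 x1 x2 z (V \<omega>) =
        selected_outcome D (\<lambda>\<omega>. x0 (V \<omega>)) (\<lambda>\<omega>. x1 (V \<omega>)) (\<lambda>\<omega>. x2 (V \<omega>)) z \<omega>" for z \<omega>
      by (simp add: selected_outcome_def proj)
    have "selected_outcome d x0 x1 x2 z \<in> borel_measurable ?S" for z
      by measurable
    moreover have "integrable M (\<lambda>\<omega>. selected_outcome d x0 x1 x2 z (V \<omega>))" for z
      unfolding eq by (intro integrable_selected_outcome int D)
    ultimately show ?thesis
      unfolding contrast[OF int, symmetric]
      using contrast_V[of "selected_outcome d x0 x1 x2" X] X by (simp add: eq)
  qed

  \<comment> \<open>First stages as probabilities of latent groups\<close>
  have FS1: "first_stage M D Z 1 = prob ?C"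
  proof -
    \<comment> \<open>Units first treated in period 2 are still untreated in period 1, hence the
      constants 0, 0, 1.\<close>
    have "first_stage M D Z 1 = (LINT \<omega>:?C|M. 1 - 0) - (LINT \<omega>:?CA|M. 0 - 0)
        + (LINT \<omega>:?NC|M. 0 - 0) - (LINT \<omega>:?NF|M. 0 - 0)"
      unfolding first_stage_def
      by (rule sel_V[of "\<lambda>_. 0" "\<lambda>_. 0" "\<lambda>_. 1"])
        (auto simp: obs_treatment_def selected_outcome_def)
    then show ?thesis using sets by (simp add: set_lebesgue_integral_def)
  qed
  have FS2: "first_stage M D Z 2 = prob ?C - prob ?CA + prob ?NC - prob ?NF"
  proof -
    \<comment> \<open>The constants are 0, 1, 1: by irreversibility, units treated in period 1
      almost surely remain treated.\<close>
    have "first_stage M D Z 2 = (LINT \<omega>:?C|M. 1 - 0) - (LINT \<omega>:?CA|M. 1 - 0)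
        + (LINT \<omega>:?NC|M. 1 - 0) - (LINT \<omega>:?NF|M. 1 - 0)"
      unfolding first_stage_def
    proof (rule sel_V[of "\<lambda>_. 0" "\<lambda>_. 1" "\<lambda>_. 1"])
      show "AE \<omega> in M. Z \<omega> = z \<longrightarrow> of_bool (obs_treatment D Z 2 \<omega>) =
          selected_outcome D (\<lambda>_. 0) (\<lambda>_. 1) (\<lambda>_. 1) z \<omega>" for z
        using irreversible'[of z]
        by eventually_elim (auto simp: obs_treatment_def selected_outcome_def)
    qed (auto simp: obs_treatment_def)
    then show ?thesis using sets by (simp add: set_lebesgue_integral_def)
  qed

  \<comment> \<open>Reduced forms in terms of causal effects\<close>
  have Yz_meas[measurable]: "Y0z 1 z \<in> borel_measurable M" "Y1z 1 0 z \<in> borel_measurable M"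
    "Y0z 2 z \<in> borel_measurable M" "Y1z 2 0 z \<in> borel_measurable M" "Y1z 2 1 z \<in> borel_measurable M" for z
    using Y0z_int[of _ z] Y1z_int[of _ _ z] by auto
  have RF1: "reduced_form M D Y0z Y1z Z 1 = ?\<delta> * prob ?C"
  proof -
    \<comment> \<open>Seen from period 1, later treatment has no outcome yet, so \<open>y01\<close>
      fills both of the first two slots and only \<open>?C\<close> contributes.\<close>
    have "reduced_form M D Y0z Y1z Z 1 = (LINT \<omega>:?C|M. Y1 1 0 \<omega> - Y0 1 \<omega>)
        - (LINT \<omega>:?CA|M. Y0 1 \<omega> - Y0 1 \<omega>)
        + (LINT \<omega>:?NC|M. Y0 1 \<omega> - Y0 1 \<omega>) - (LINT \<omega>:?NF|M. Y0 1 \<omega> - Y0 1 \<omega>)"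
      unfolding reduced_form_def
    proof (rule sel_V[of y01 y01 y10, unfolded proj])
      have "(\<lambda>\<omega>. if D 1 (Z \<omega>) \<omega> then Y1z 1 0 (Z \<omega>) \<omega> else Y0z 1 (Z \<omega>) \<omega>) \<in> borel_measurable M"
        by (rule measurable_compose_countable'[where I = UNIV]) auto
      then show "obs_outcome D Y0z Y1z Z 1 \<in> borel_measurable M"
        unfolding obs_outcome_1[abs_def] .
      show "AE \<omega> in M. Z \<omega> = z \<longrightarrow> obs_outcome D Y0z Y1z Z 1 \<omega> =
          selected_outcome D (Y0 1) (Y0 1) (Y1 1 0) z \<omega>" for z
        using Y0_eq[of 1 z, simplified] Y1_eq[of 1 0 z, simplified]
        by eventually_elim (auto simp: obs_outcome_1 selected_outcome_def)
    qed (use Yint in auto)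
    then show ?thesis
      using set_integral_eq_cond_exp_event[OF finite_measure_axioms sets(1)]
      by (simp add: causal_effect_def set_lebesgue_integral_def)
  qed
  have RF2: "reduced_form M D Y0z Y1z Z 2 = causal_effect M Y0 Y1 1 2 ?C * prob ?C
      - ?\<delta> * prob ?CA + ?\<delta> * prob ?NC - ?\<delta> * prob ?NF"
  proof -
    have "reduced_form M D Y0z Y1z Z 2 = (LINT \<omega>:?C|M. Y1 2 1 \<omega> - Y0 2 \<omega>)
        - (LINT \<omega>:?CA|M. Y1 2 0 \<omega> - Y0 2 \<omega>)
        + (LINT \<omega>:?NC|M. Y1 2 0 \<omega> - Y0 2 \<omega>) - (LINT \<omega>:?NF|M. Y1 2 0 \<omega> - Y0 2 \<omega>)"
      unfolding reduced_form_def
    proof (rule sel_V[of y02 y20 y21, unfolded proj])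
      have "(\<lambda>\<omega>. selected_outcome D (Y0z 2 (Z \<omega>)) (Y1z 2 0 (Z \<omega>)) (Y1z 2 1 (Z \<omega>)) (Z \<omega>) \<omega>)
          \<in> borel_measurable M"
        by (rule measurable_compose_countable'[where I = UNIV]) auto
      then show "obs_outcome D Y0z Y1z Z 2 \<in> borel_measurable M"
        unfolding obs_outcome_2[abs_def] .
      show "AE \<omega> in M. Z \<omega> = z \<longrightarrow> obs_outcome D Y0z Y1z Z 2 \<omega> =
          selected_outcome D (Y0 2) (Y1 2 0) (Y1 2 1) z \<omega>" for z
        using Y0_eq[of 2 z, simplified] Y1_eq[of 2 0 z, simplified] Y1_eq[of 2 1 z, simplified]
        by eventually_elim (auto simp: obs_outcome_2 selected_outcome_def)
    qed (use Yint in auto)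
    moreover have "(LINT \<omega>:g|M. Y1 2 0 \<omega> - Y0 2 \<omega>) = ?\<delta> * prob g" if "g \<in> {?CA, ?NC, ?NF}" for g
    proof -
      have "(LINT \<omega>:g|M. Y1 2 0 \<omega> - Y0 2 \<omega>) = causal_effect M Y0 Y1 0 2 g * prob g"
        unfolding causal_effect_def
        using that sets by (intro set_integral_eq_cond_exp_event finite_measure_axioms) auto
      \<comment> \<open>Homogeneity speaks of groups of positive probability only; for a null group
        both sides of the claim are 0.\<close>
      moreover have "prob g = 0 \<or> ?\<delta> = causal_effect M Y0 Y1 0 2 g"
        using homogeneity that by (metis zero_less_measure_iff)
      ultimately show ?thesis by auto
    qed
    ultimately show ?thesis
      using set_integral_eq_cond_exp_event[OF finite_measure_axioms sets(1)]
      by (simp add: causal_effect_def)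
  qed
  \<comment> \<open>What remains is algebra: \<open>RF2\<close> says that the reduced form is the
    two-period effect times \<open>prob ?C\<close> minus \<open>?\<delta>\<close> times the
    difference of the first stages, \<open>RF1\<close> identifies \<open>?\<delta>\<close>, and
    relevance allows division by \<open>prob ?C\<close>.\<close>
  have "prob ?C \<noteq> 0"
    using relevance FS1 by simp
  then show ?thesis
    unfolding FS1 FS2 RF1 RF2 by (simp add: field_simps)
qed

end
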